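(* In Specker's scenario, the four noncontextuality inequalities $R_3\le 3-\eta_0$, $R_0\le 1-\eta_0$, $R_1\le 1-\eta_0$, $R_2\le 1-\eta_0$ are equivalent under relabelling of measurement outcomes. Precisely, for any pairwise joint distributions $p(X_i,X_j|M_{ij},P)$, $(ij)\in\{(12),(23),(13)\}$, and $m\in\{1,2,3\}$, let $R_3'$ denote the expression $R_3$ evaluated on the distributions obtained by relabelling the outcomes of $M_m$ as $X_m\mapsto X_m'=1-X_m$ (the outcomes of the other two measurements being unchanged). Then the inequality $R_3'\le 3-\eta_0$ is equivalent to $R_0\le 1-\eta_0$ if $m=3$, to $R_2\le 1-\eta_0$ if $m=2$, and to $R_1\le 1-\eta_0$ if $m=1$. The same holds for the KS inequalities $R_3\le2$, $R_0\le0$, $R_1\le0$, $R_2\le0$ (the case $\eta_0=1$).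
   Context: Specker's scenario: three binary measurements $M_1,M_2,M_3$ with outcomes $X_i\in\{0,1\}$, pairwise jointly measurable, with statistics $p(X_i,X_j|M_{ij},P)$ for each joint measurement $M_{ij}$, $(ij)\in\{(12),(23),(13)\}$, on a preparation $P$. With $w_{ij}\equiv p(X_i\neq X_j|M_{ij},P)$, $$R_3\equiv w_{12}+w_{23}+w_{13},\quad R_0\equiv w_{12}-w_{23}-w_{13},\quad R_1\equiv w_{23}-w_{13}-w_{12},\quad R_2\equiv w_{13}-w_{12}-w_{23}.$$ $\eta_0\in[0,1]$ is the common predictability of the three measurements, $\eta_0=\max_P\{2\max_{X_k}p(X_k|M_k,P)-1\}$ (assumed the same for $k=1,2,3$); it is unchanged by relabelling outcomes. *)

theory Defs
  imports "HOL-Probability.Probability" "HOL-Library.Z2"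
begin

text \<open>
  Outcomes are elements of \<open>bit\<close> (values 0 and 1), so that \<open>1 - x\<close> exchanges the two outcomes.
  Measurements are indexed by 1, 2, 3. \<open>M k P\<close> is the outcome distribution of the measurement
  \<open>M\<^sub>k\<close> on the preparation \<open>P\<close>, and \<open>J i j P\<close> is that of the joint measurement \<open>M\<^sub>i\<^sub>j\<close>; only the
  values of \<open>J\<close> at the pairs in \<open>contexts\<close> are meaningful.
\<close>

type_synonym 'prep single_stats = "nat \<Rightarrow> 'prep \<Rightarrow> bit pmf"
type_synonym 'prep joint_stats = "nat \<Rightarrow> nat \<Rightarrow> 'prep \<Rightarrow> (bit \<times> bit) pmf"

definition contexts :: "(nat \<times> nat) set" where
  "contexts = {(1, 2), (2, 3), (1, 3)}"

text \<open>Joint measurability: each \<open>M\<^sub>i\<^sub>j\<close> has the statistics of \<open>M\<^sub>i\<close> and \<open>M\<^sub>j\<close> as its marginals.\<close>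

definition specker_scenario :: "'prep single_stats \<Rightarrow> 'prep joint_stats \<Rightarrow> bool" where
  "specker_scenario M J \<longleftrightarrow>
     (\<forall>(i, j)\<in>contexts. \<forall>P. map_pmf fst (J i j P) = M i P \<and> map_pmf snd (J i j P) = M j P)"

definition w :: "'prep joint_stats \<Rightarrow> nat \<Rightarrow> nat \<Rightarrow> 'prep \<Rightarrow> real" where
  "w J i j P = measure_pmf.prob (J i j P) {(x, y). x \<noteq> y}"

definition R3 :: "'prep joint_stats \<Rightarrow> 'prep \<Rightarrow> real" where
  "R3 J P = w J 1 2 P + w J 2 3 P + w J 1 3 P"

definition R0 :: "'prep joint_stats \<Rightarrow> 'prep \<Rightarrow> real" where
  "R0 J P = w J 1 2 P - w J 2 3 P - w J 1 3 P"

definition R1 :: "'prep joint_stats \<Rightarrow> 'prep \<Rightarrow> real" where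
  "R1 J P = w J 2 3 P - w J 1 3 P - w J 1 2 P"

definition R2 :: "'prep joint_stats \<Rightarrow> 'prep \<Rightarrow> real" where
  "R2 J P = w J 1 3 P - w J 1 2 P - w J 2 3 P"

definition pred_at :: "'prep single_stats \<Rightarrow> nat \<Rightarrow> 'prep \<Rightarrow> real" where
  "pred_at M k P = 2 * (MAX x. pmf (M k P) x) - 1"

text \<open>
  \<open>\<eta>\<close> is the maximum over preparations, for each of the three measurements. A maximum over an
  infinite family need not be attained, so this is a relation rather than a function of \<open>M\<close>.
\<close>

definition common_predictability :: "'prep single_stats \<Rightarrow> real \<Rightarrow> bool" where
  "common_predictability M \<eta> \<longleftrightarrow>
     (\<forall>k\<in>{1, 2, 3}. (\<exists>P. pred_at M k P = \<eta>) \<and> (\<forall>P. pred_at M k P \<le> \<eta>))"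

definition flip :: "nat \<Rightarrow> nat \<Rightarrow> bit \<Rightarrow> bit" where
  "flip m k x = (if k = m then 1 - x else x)"

definition relabel_single :: "nat \<Rightarrow> 'prep single_stats \<Rightarrow> 'prep single_stats" where
  "relabel_single m M k P = map_pmf (flip m k) (M k P)"

definition relabel_joint :: "nat \<Rightarrow> 'prep joint_stats \<Rightarrow> 'prep joint_stats" where
  "relabel_joint m J i j P = map_pmf (map_prod (flip m i) (flip m j)) (J i j P)"

lemma specker_scenario_relabel:
  assumes "specker_scenario M J"
  shows "specker_scenario (relabel_single m M) (relabel_joint m J)"
proof -
  have "map_pmf fst (relabel_joint m J i j P) = map_pmf (flip m i) (map_pmf fst (J i j P))"
    and "map_pmf snd (relabel_joint m J i j P) = map_pmf (flip m j) (map_pmf snd (J i j P))"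
    for i j P
    by (simp_all add: relabel_joint_def pmf.map_comp o_def)
  with assms show ?thesis
    by (auto simp: specker_scenario_def relabel_single_def)
qed

lemma flip_flip [simp]: "flip m k (flip m k x) = x"
  by (simp add: flip_def)

lemma pred_at_relabel: "pred_at (relabel_single m M) k P = pred_at M k P"
proof -
  have inj: "inj (flip m k)"
    by (metis flip_flip injI)
  have "pmf (relabel_single m M k P) x = pmf (M k P) (flip m k x)" for x
    using pmf_map_inj'[OF inj, of "M k P" "flip m k x"] by (simp add: relabel_single_def)
  then have "range (pmf (relabel_single m M k P)) = pmf (M k P) ` range (flip m k)"
    by (auto simp: image_iff)
  also have "range (flip m k) = UNIV"
    by (metis flip_flip surjI)
  finally show ?thesis
    by (simp add: pred_at_def)
qed

lemma common_predictability_relabel: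
  "common_predictability (relabel_single m M) \<eta> \<longleftrightarrow> common_predictability M \<eta>"
  by (simp add: common_predictability_def pred_at_relabel)

lemma bit_UNIV: "(UNIV :: bit set) = {0, 1}"
  by (auto intro: bit.exhaust)

lemma pred_at_bounds: "0 \<le> pred_at M k P" "pred_at M k P \<le> 1"
proof -
  have "pmf (M k P) 0 + pmf (M k P) 1 = 1"
    using sum_pmf_eq_1[of "UNIV :: bit set" "M k P", OF _ subset_UNIV] by (simp add: bit_UNIV)
  moreover have "(MAX x. pmf (M k P) x) = max (pmf (M k P) 0) (pmf (M k P) 1)"
    by (simp add: bit_UNIV)
  ultimately show "0 \<le> pred_at M k P" "pred_at M k P \<le> 1"
    using pmf_le_1[of "M k P" 0] pmf_le_1[of "M k P" 1] by (auto simp: pred_at_def)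
qed

lemma common_predictability_bounds:
  assumes "common_predictability M \<eta>"
  shows "\<eta> \<in> {0..1}"
proof -
  from assms obtain P where "pred_at M 1 P = \<eta>"
    by (auto simp: common_predictability_def)
  then show ?thesis
    using pred_at_bounds[of M 1 P] by simp
qed

end

theory Submission imports Defs begin

text \<open>Outcomes are two-valued, so relabelling \<open>M m\<close> swaps agreement and
  disagreement in the two contexts containing m: there \<open>w\<close> becomes 1 - \<open>w\<close>
  (\<open>w_relabel_joint\<close>), while the third context keeps its \<open>w\<close>. Summing,
  \<open>R3\<close> turns into 2 plus one of \<open>R0\<close>, \<open>R1\<close>, \<open>R2\<close>
  (\<open>R3_relabel_joint\<close>), and every equivalence is a shift of both sides by 2.\<close>

lemma w_relabel_joint:
  assumes "i \<noteq> j"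
  shows "w (relabel_joint m J) i j P = (if m = i \<or> m = j then 1 - w J i j P else w J i j P)"
proof -
  let ?f = "map_prod (flip m i) (flip m j)"
  \<comment> \<open>As i and j differ, at most one of the two outcomes is flipped; a single flip of
    a bit turns equality into inequality.\<close>
  have flip_eq: "flip m i x = flip m j y \<longleftrightarrow> (if m = i \<or> m = j then x \<noteq> y else x = y)" for x y
    using assms by (cases x; cases y) (auto simp: flip_def)
  have w_vimage: "w (relabel_joint m J) i j P = measure_pmf.prob (J i j P) (?f -` {(x, y). x \<noteq> y})"
    by (simp add: w_def relabel_joint_def)
  show ?thesis
  proof (cases "m = i \<or> m = j")
    case True
    then have "?f -` {(x, y). x \<noteq> y} = - {(x, y). x \<noteq> y}"
      by (simp add: set_eq_iff flip_eq)
    then show ?thesis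
      using True w_vimage measure_pmf.prob_compl[of "{(x, y). x \<noteq> y}" "J i j P"]
      by (simp add: w_def Compl_eq_Diff_UNIV)
  next
    case False
    then have "?f -` {(x, y). x \<noteq> y} = {(x, y). x \<noteq> y}"
      by (simp add: set_eq_iff flip_eq)
    then show ?thesis
      using False w_vimage by (simp add: w_def)
  qed
qed

text \<open>The two contexts containing m contribute 1 - \<open>w\<close> each, hence the 2; the
  only \<open>w\<close> left with a plus sign is that of the context avoiding m, namely (12), (13),
  (23) for m = 3, 2, 1.\<close>

lemma R3_relabel_joint:
  "R3 (relabel_joint 3 J) P = 2 + R0 J P"
  "R3 (relabel_joint 2 J) P = 2 + R2 J P"
  "R3 (relabel_joint 1 J) P = 2 + R1 J P"
  by (simp_all add: R3_def R0_def R1_def R2_def w_relabel_joint)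

theorem mainTheorem4:
  fixes M :: "'prep single_stats" and J :: "'prep joint_stats"
    and \<eta>\<^sub>0 :: real and P :: 'prep
  assumes "specker_scenario M J"
  shows "(common_predictability M \<eta>\<^sub>0 \<longrightarrow>
            (R3 (relabel_joint 3 J) P \<le> 3 - \<eta>\<^sub>0 \<longleftrightarrow> R0 J P \<le> 1 - \<eta>\<^sub>0) \<and>
            (R3 (relabel_joint 2 J) P \<le> 3 - \<eta>\<^sub>0 \<longleftrightarrow> R2 J P \<le> 1 - \<eta>\<^sub>0) \<and>
            (R3 (relabel_joint 1 J) P \<le> 3 - \<eta>\<^sub>0 \<longleftrightarrow> R1 J P \<le> 1 - \<eta>\<^sub>0)) \<and>
         (R3 (relabel_joint 3 J) P \<le> 2 \<longleftrightarrow> R0 J P \<le> 0) \<and>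
         (R3 (relabel_joint 2 J) P \<le> 2 \<longleftrightarrow> R2 J P \<le> 0) \<and>
         (R3 (relabel_joint 1 J) P \<le> 2 \<longleftrightarrow> R1 J P \<le> 0)"
  \<comment> \<open>Cancelling 2 turns the bound 3 - \<open>\<eta>\<^sub>0\<close> into 1 -
    \<open>\<eta>\<^sub>0\<close>, and the KS bound 2 into 0.\<close>
  unfolding R3_relabel_joint by auto

end
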